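(* Let $\boldsymbol{B}\in\mathbb{R}^{n\times n}$ be upper triangular and with zeroes on the diagonal. The following are equivalent: (i) $B_{i,i+1}\neq0$ for every $i\in\{1,\ldots,n-1\}$. (ii) There exists an invertible, upper triangular matrix $\boldsymbol{Q}\in\mathbb{R}^{n\times n}$ such that $\boldsymbol{B}=\boldsymbol{Q}\boldsymbol{J}_n\boldsymbol{Q}^{-1}$. (iii) The eigenvalue $0$ of $\boldsymbol{B}$ has geometric multiplicity equal to one. (iv) If $\boldsymbol{A}(x)=x^{\boldsymbol{B}}$ for $x\in(0,\infty)$, then the functions $A_{1j}$, $j\in\{2,\ldots,n\}$, are linearly independent. In this case, for a rate vector $\boldsymbol{g}$ of length $n$ and $\boldsymbol{Q}$ as in (ii), $\boldsymbol{g}\in R_{\boldsymbol{B}}$ if and only if $\boldsymbol{Q}^{-1}\boldsymbol{g}\in R_{\boldsymbol{J}_n}$.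
   Context: $\boldsymbol{J}_n$ is the $n\times n$ Jordan block with zero diagonal: $(\boldsymbol{J}_n)_{i,i+1}=1$ for $i\in\{1,\ldots,n-1\}$ and all other entries $0$. For a square matrix $\boldsymbol{B}$ and $x>0$, $x^{\boldsymbol{B}}=\exp\{(\log x)\boldsymbol{B}\}$. Limit relations are as $t\to\infty$; measurability is Lebesgue. A real function is defined in a neighbourhood of infinity if its domain contains some $[t_0,\infty)$; it is eventually of constant sign if it is either strictly positive for all large $t$ or strictly negative for all large $t$. A rate vector of length $n$ is a column vector $\boldsymbol{g}=(g_1,\ldots,g_n)'$ of real-valued functions defined in a neighbourhood of infinity, each eventually of constant sign, with $g_{i+1}(t)=o(g_i(t))$ for every $i\in\{1,\ldots,n-1\}$; $o(g_n(t))$ means $o(|g_n(t)|)$, componentwise for vectors. An index matrix is an upper triangular matrix in $\mathbb{R}^{n\times n}$ whose diagonal elements are non-increasing and all of whose eigenvalues, except possibly the smallest one, have geometric multiplicity one. For an index matrix $\boldsymbol{B}$, a rate vector $\boldsymbol{g}$ belongs to $R_{\boldsymbol{B}}$ (is regularly varying with index matrix $\boldsymbol{B}$) if $\boldsymbol{g}$ is measurable and $\boldsymbol{g}(xt)=x^{\boldsymbol{B}}\boldsymbol{g}(t)+o(g_n(t))$ for every $x\in(0,\infty)$. *)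

theory Defs
  imports
    "HOL-Analysis.Lebesgue_Measure"
    "HOL-Library.Landau_Symbols"
    "Jordan_Normal_Form.Jordan_Normal_Form"
    "Jordan_Normal_Form.Matrix_Kernel"
begin

unbundle no vec_syntax

text \<open>
  Vectors and matrices are those of \<^theory>\<open>Jordan_Normal_Form.Matrix\<close>, hence indexed from \<open>0\<close>;
  the nilpotent Jordan block of size \<open>n\<close> is \<open>jordan_block n 0\<close>.
\<close>

definition mat_exp :: "real mat \<Rightarrow> real mat" where
  "mat_exp A = mat (dim_row A) (dim_row A) (\<lambda>(i, j). \<Sum>k. (A ^\<^sub>m k) $$ (i, j) / fact k)"

definition mat_powr :: "real \<Rightarrow> real mat \<Rightarrow> real mat" where
  "mat_powr x B = mat_exp (ln x \<cdot>\<^sub>m B)"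

text \<open>\<^const>\<open>char_matrix\<close> \<open>A e\<close> is \<open>A - e I\<close>.\<close>

definition geometric_multiplicity :: "real mat \<Rightarrow> real \<Rightarrow> nat" where
  "geometric_multiplicity A e = kernel_dim (char_matrix A e)"

text \<open>
  Independence of a family rather than of a set: a family with a repeated member is dependent.
  The functions are regarded as functions on \<open>S\<close> only.
\<close>

definition lin_indep_family_on :: "real set \<Rightarrow> 'i set \<Rightarrow> ('i \<Rightarrow> real \<Rightarrow> real) \<Rightarrow> bool" where
  "lin_indep_family_on S I f \<longleftrightarrow>
     (\<forall>J c. finite J \<and> J \<subseteq> I \<and> (\<forall>x\<in>S. (\<Sum>j\<in>J. c j * f j x) = 0) \<longrightarrow> (\<forall>j\<in>J. c j = 0))"

text \<open>
  An upper triangular real matrix has only real eigenvalues, so the real \<^const>\<open>eigenvalue\<close>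
  covers all of them.
\<close>

definition index_matrix :: "nat \<Rightarrow> real mat \<Rightarrow> bool" where
  "index_matrix n B \<longleftrightarrow>
     B \<in> carrier_mat n n \<and> upper_triangular B \<and>
     (\<forall>i j. i \<le> j \<and> j < n \<longrightarrow> B $$ (j, j) \<le> B $$ (i, i)) \<and>
     (\<forall>e. eigenvalue B e \<and> (\<exists>e'. eigenvalue B e' \<and> e' < e) \<longrightarrow> geometric_multiplicity B e = 1)"

definition eventually_constant_sign :: "(real \<Rightarrow> real) \<Rightarrow> bool" where
  "eventually_constant_sign f \<longleftrightarrow>
     (\<forall>\<^sub>F t in at_top. f t > 0) \<or> (\<forall>\<^sub>F t in at_top. f t < 0)"

text \<open>
  A vector of partial functions is a total function \<open>g\<close> together with its domain \<open>D\<close>,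
  the common domain of the components; the values of \<open>g\<close> outside \<open>D\<close> are irrelevant.
\<close>

definition rate_vector :: "nat \<Rightarrow> real set \<Rightarrow> (real \<Rightarrow> real Matrix.vec) \<Rightarrow> bool" where
  "rate_vector n D g \<longleftrightarrow>
     (\<exists>t0. {t0..} \<subseteq> D) \<and>
     (\<forall>t\<in>D. g t \<in> carrier_vec n) \<and>
     (\<forall>i<n. eventually_constant_sign (\<lambda>t. g t $ i)) \<and>
     (\<forall>i. Suc i < n \<longrightarrow> (\<lambda>t. g t $ Suc i) \<in> o(\<lambda>t. g t $ i))"

text \<open>
  Preimages under a measurable partial function are Lebesgue sets; in particular its domain is.
\<close>

definition measurable_vector :: "nat \<Rightarrow> real set \<Rightarrow> (real \<Rightarrow> real Matrix.vec) \<Rightarrow> bool" where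
  "measurable_vector n D g \<longleftrightarrow>
     D \<in> sets lebesgue \<and> (\<forall>i<n. (\<lambda>t. g t $ i) \<in> borel_measurable (lebesgue_on D))"

text \<open>\<open>g \<in> R\<^sub>B\<close>, for \<open>g\<close> with domain \<open>D\<close>.\<close>

definition regularly_varying ::
    "nat \<Rightarrow> real mat \<Rightarrow> real set \<Rightarrow> (real \<Rightarrow> real Matrix.vec) \<Rightarrow> bool" where
  "regularly_varying n B D g \<longleftrightarrow>
     index_matrix n B \<and> rate_vector n D g \<and> measurable_vector n D g \<and>
     (\<forall>x>0. \<forall>i<n. (\<lambda>t. (g (x * t) - mat_powr x B *\<^sub>v g t) $ i) \<in> o(\<lambda>t. g t $ (n - 1)))"

end

theory Submission
  imports Defs "Jordan_Normal_Form.Jordan_Normal_Form_Uniqueness"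
begin

text \<open>
  If \<open>B\<close> is strictly upper triangular, then \<open>(B ^ k)(i, j)\<close> vanishes for \<open>j < i + k\<close>, and on the diagonal
  \<open>j = i + k\<close> it is a product of superdiagonal entries of \<open>B\<close>. Each of the four conditions thus
  reduces to the non-vanishing of a triangular determinant whose diagonal entries are such products.
  The last claim holds because \<open>x\<^sup>B = Q x\<^sup>J Q\<^sup>-\<^sup>1\<close> and because an invertible upper triangular matrix
  changes the components of a rate vector only by nonzero factors, asymptotically.
\<close>

section \<open>Strictly upper triangular matrices and their powers\<close>

definition strictly_upper_triangular :: "'a::zero mat \<Rightarrow> bool" where
  "strictly_upper_triangular A \<longleftrightarrow> (\<forall>i<dim_row A. \<forall>j\<le>i. A $$ (i, j) = 0)"

lemma strictly_upper_triangularD: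
  "strictly_upper_triangular A \<Longrightarrow> i < dim_row A \<Longrightarrow> j \<le> i \<Longrightarrow> A $$ (i, j) = 0"
  by (simp add: strictly_upper_triangular_def)

lemma strictly_upper_triangular_iff:
  "strictly_upper_triangular A \<longleftrightarrow> upper_triangular A \<and> (\<forall>i<dim_row A. A $$ (i, i) = 0)"
  unfolding strictly_upper_triangular_def upper_triangular_def by (auto simp: le_less)

lemma strictly_upper_triangular_jordan_block:
  "strictly_upper_triangular (jordan_block n 0)"
  by (auto simp: strictly_upper_triangular_def)

lemma index_mult_mat_sum:
  assumes "A \<in> carrier_mat n m" "B \<in> carrier_mat m k" "i < n" "j < k"
  shows "(A * B) $$ (i, j) = (\<Sum>l<m. A $$ (i, l) * B $$ (l, j))"
  using assms by (simp add: scalar_prod_def atLeast0LessThan)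

lemma index_mult_mat_vec_sum:
  assumes "A \<in> carrier_mat n m" "v \<in> carrier_vec m" "i < n"
  shows "(A *\<^sub>v v) $ i = (\<Sum>l<m. A $$ (i, l) * v $ l)"
  using assms by (simp add: scalar_prod_def atLeast0LessThan)

context
  fixes A :: "'a::comm_ring_1 mat" and n :: nat
  assumes A: "A \<in> carrier_mat n n" and strict: "strictly_upper_triangular A"
begin

text \<open>Each factor moves the column index at least one place to the right. In the sum over the
  intermediate index \<open>l\<close>, the induction hypothesis removes \<open>l < i + k\<close>;
  for the other \<open>l\<close>, \<open>j \<le> i + k \<le> l\<close> makes
  \<open>A $$ (l, j)\<close> vanish.\<close>

lemma strictly_upper_triangular_pow_eq_0:
  assumes "i < n" "j < n" "j < i + k"
  shows "(A ^\<^sub>m k) $$ (i, j) = 0"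
  using assms(2,3)
proof (induction k arbitrary: j)
  case 0
  then show ?case using A assms(1) by simp
next
  case (Suc k)
  have "(A ^\<^sub>m Suc k) $$ (i, j) = (\<Sum>l<n. (A ^\<^sub>m k) $$ (i, l) * A $$ (l, j))"
    using A assms(1) Suc.prems
      by (simp add: index_mult_mat_sum[of _ n n _ n] del: index_mult_mat(1) assoc_mult_mat)
  also have "\<dots> = 0"
  proof (rule sum.neutral, rule ballI)
    fix l assume l: "l \<in> {..<n}"
    show "(A ^\<^sub>m k) $$ (i, l) * A $$ (l, j) = 0"
    proof (cases "l < i + k")
      case True
      then show ?thesis using Suc.IH l by simp
    next
      case False
      then have "A $$ (l, j) = 0"
        using Suc.prems A l by (intro strictly_upper_triangularD[OF strict]) auto
      then show ?thesis by simp
    qed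
  qed
  finally show ?case .
qed

text \<open>Reaching column \<open>i + k\<close> in \<open>k\<close> steps leaves only unit steps,
  so a single path contributes: in the sum over the intermediate index only \<open>l = i + k\<close>
  survives.\<close>

lemma strictly_upper_triangular_pow_diagonal:
  assumes "i + k < n"
  shows "(A ^\<^sub>m k) $$ (i, i + k) = (\<Prod>m<k. A $$ (i + m, Suc (i + m)))"
  using assms
proof (induction k)
  case 0
  then show ?case using A by simp
next
  case (Suc k)
  have "(A ^\<^sub>m Suc k) $$ (i, i + Suc k) = (\<Sum>l<n. (A ^\<^sub>m k) $$ (i, l) * A $$ (l, i + Suc k))"
    using A Suc.prems
      by (simp add: index_mult_mat_sum[of _ n n _ n] del: index_mult_mat(1) assoc_mult_mat)
  also have "\<dots> = (\<Sum>l\<in>{i + k}. (A ^\<^sub>m k) $$ (i, l) * A $$ (l, i + Suc k))"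
  proof (rule sum.mono_neutral_right)
    show "\<forall>l\<in>{..<n} - {i + k}. (A ^\<^sub>m k) $$ (i, l) * A $$ (l, i + Suc k) = 0"
    proof
      fix l assume l: "l \<in> {..<n} - {i + k}"
      show "(A ^\<^sub>m k) $$ (i, l) * A $$ (l, i + Suc k) = 0"
      proof (cases "l < i + k")
        case True
        then show ?thesis using strictly_upper_triangular_pow_eq_0[of i l k] l Suc.prems by simp
      next
        case False
        then have "A $$ (l, i + Suc k) = 0"
          using l A by (intro strictly_upper_triangularD[OF strict]) auto
        then show ?thesis by simp
      qed
    qed
  qed (use Suc.prems in auto)
  finally show ?case using Suc by (simp add: mult.commute)
qed

end

section \<open>The matrix function \<open>mat_powr\<close> on strictly upper triangular
  matrices\<close>

lemma smult_pow_mat_index: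
  fixes A :: "'a::comm_ring_1 mat"
  assumes A: "A \<in> carrier_mat n n" and "i < n" "j < n"
  shows "((c \<cdot>\<^sub>m A) ^\<^sub>m k) $$ (i, j) = c ^ k * (A ^\<^sub>m k) $$ (i, j)"
  using assms(3)
proof (induction k arbitrary: j)
  case 0
  then show ?case using A by simp
next
  case (Suc k)
  then show ?case using A \<open>i < n\<close>
    by (simp add: index_mult_mat_sum[of _ n n _ n] sum_distrib_left mult_ac
        del: index_mult_mat(1) assoc_mult_mat)
qed

lemma mat_powr_carrier: "A \<in> carrier_mat n n \<Longrightarrow> mat_powr x A \<in> carrier_mat n n"
  by (simp add: mat_powr_def mat_exp_def)

text \<open>The exponential series stops because \<open>A\<close> is nilpotent: for
  \<open>k \<ge> n\<close> one has \<open>j < n \<le> i + k\<close>, so the entry of the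
  \<open>k\<close>-th power is zero. Every entry is thus a polynomial in
  \<open>ln x\<close>.\<close>

lemma mat_powr_index_strictly_upper_triangular:
  assumes A: "A \<in> carrier_mat n n" and strict: "strictly_upper_triangular A"
    and ij: "i < n" "j < n"
  shows "mat_powr x A $$ (i, j) = (\<Sum>k<n. ln x ^ k / fact k * (A ^\<^sub>m k) $$ (i, j))"
proof -
  have "mat_powr x A $$ (i, j) = (\<Sum>k. ln x ^ k / fact k * (A ^\<^sub>m k) $$ (i, j))"
    using A ij by (simp add: mat_powr_def mat_exp_def smult_pow_mat_index[OF A])
  also have "\<dots> = (\<Sum>k<n. ln x ^ k / fact k * (A ^\<^sub>m k) $$ (i, j))"
    by (rule suminf_finite)
      (use ij in \<open>auto simp: strictly_upper_triangular_pow_eq_0[OF A strict]\<close>)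
  finally show ?thesis .
qed

text \<open>Conjugation commutes with each power, hence with the exponential. As both series are
  finite sums here, the interchange of summations raises no question of convergence.\<close>

lemma mat_powr_similar:
  assumes A: "A \<in> carrier_mat n n" and wit: "similar_mat_wit A B P Q"
    and strict: "strictly_upper_triangular A" "strictly_upper_triangular B"
  shows "mat_powr x A = P * mat_powr x B * Q"
proof (rule eq_matI)
  note W = similar_mat_witD2[OF A wit]
  note C = mat_powr_carrier[OF A, of x] mat_powr_carrier[OF W(5), of x]
  fix i j assume "i < dim_row (P * mat_powr x B * Q)" "j < dim_col (P * mat_powr x B * Q)"
  then have ij: "i < n" "j < n" using W by auto
  have pw: "(A ^\<^sub>m k) $$ (i, j) = (\<Sum>m<n. (\<Sum>l<n. P $$ (i, l) * (B ^\<^sub>m k) $$ (l, m)) * Q $$ (m, j))" for k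
    unfolding similar_mat_wit_pow_id[OF wit]
    using W ij by (simp add: index_mult_mat_sum[of _ n n _ n] del: index_mult_mat(1) assoc_mult_mat)
  have "(P * mat_powr x B * Q) $$ (i, j)
      = (\<Sum>m<n. (\<Sum>l<n. P $$ (i, l) * (\<Sum>k<n. ln x ^ k / fact k * (B ^\<^sub>m k) $$ (l, m))) * Q $$ (m, j))"
    using W C ij
    by (simp add: index_mult_mat_sum[of _ n n _ n] mat_powr_index_strictly_upper_triangular[OF W(5) strict(2)]
        del: index_mult_mat(1) assoc_mult_mat)
  also have "\<dots> = (\<Sum>m<n. \<Sum>l<n. \<Sum>k<n. ln x ^ k / fact k * (P $$ (i, l) * (B ^\<^sub>m k) $$ (l, m) * Q $$ (m, j)))"
    by (simp add: sum_distrib_left sum_distrib_right mult_ac)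
  also have "\<dots> = (\<Sum>m<n. \<Sum>k<n. \<Sum>l<n. ln x ^ k / fact k * (P $$ (i, l) * (B ^\<^sub>m k) $$ (l, m) * Q $$ (m, j)))"
    by (rule sum.cong[OF refl], rule sum.swap)
  also have "\<dots> = (\<Sum>k<n. \<Sum>m<n. \<Sum>l<n. ln x ^ k / fact k * (P $$ (i, l) * (B ^\<^sub>m k) $$ (l, m) * Q $$ (m, j)))"
    by (rule sum.swap)
  also have "\<dots> = mat_powr x A $$ (i, j)"
    by (simp add: mat_powr_index_strictly_upper_triangular[OF A strict(1) ij] pw
        sum_distrib_left sum_distrib_right)
  finally show "mat_powr x A $$ (i, j) = (P * mat_powr x B * Q) $$ (i, j)" by simp
qed (use similar_mat_witD2[OF A wit] mat_powr_carrier[OF A, of x] in auto)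

section \<open>Determinants and inverses of upper triangular matrices\<close>

lemma det_upper_triangular_neq_0_iff:
  fixes A :: "'a::idom mat"
  assumes "A \<in> carrier_mat n n" "upper_triangular A"
  shows "det A \<noteq> 0 \<longleftrightarrow> (\<forall>i<n. A $$ (i, i) \<noteq> 0)"
  using assms by (auto simp: upper_triangular_imp_det_eq_0_iff diag_mat_def)

lemma det_mult_eq_1_neq_0:
  fixes P Q :: "'a::field mat"
  assumes "P \<in> carrier_mat n n" "Q \<in> carrier_mat n n" "P * Q = 1\<^sub>m n"
  shows "det P \<noteq> 0" "det Q \<noteq> 0"
  using det_mult[OF assms(1,2)] assms(3) by auto

text \<open>Induction from the bottom row upwards: below the diagonal, the entry
  \<open>(i, j)\<close> of \<open>P * Q = 1\<^sub>m n\<close> reduces to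
  \<open>P $$ (i, i) * Q $$ (i, j) = 0\<close>, since the terms with \<open>l < i\<close> vanish by
  triangularity of \<open>P\<close> and those with \<open>l > i\<close> by the rows already
  treated.\<close>

lemma upper_triangular_inverse:
  fixes P Q :: "'a::field mat"
  assumes P: "P \<in> carrier_mat n n" and Q: "Q \<in> carrier_mat n n"
    and PQ: "P * Q = 1\<^sub>m n" and upper: "upper_triangular P"
  shows "upper_triangular Q"
proof
  have diag: "P $$ (i, i) \<noteq> 0" if "i < n" for i
    using that det_mult_eq_1_neq_0[OF P Q PQ] det_upper_triangular_neq_0_iff[OF P upper] by blast
  fix i j assume "j < i" "i < dim_row Q"
  then have "i < n" "j < i" using Q by auto
  then show "Q $$ (i, j) = 0"
  proof (induction "n - i" arbitrary: i rule: less_induct)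
    case less
    have "0 = (P * Q) $$ (i, j)" using less.prems unfolding PQ by simp
    also have "\<dots> = (\<Sum>l<n. P $$ (i, l) * Q $$ (l, j))"
      using P Q less.prems
        by (simp add: index_mult_mat_sum[of _ n n _ n] del: index_mult_mat(1) assoc_mult_mat)
    also have "\<dots> = (\<Sum>l\<in>{i}. P $$ (i, l) * Q $$ (l, j))"
    proof (rule sum.mono_neutral_right)
      show "\<forall>l\<in>{..<n} - {i}. P $$ (i, l) * Q $$ (l, j) = 0"
      proof
        fix l assume l: "l \<in> {..<n} - {i}"
        show "P $$ (i, l) * Q $$ (l, j) = 0"
        proof (cases "l < i")
          case True
          then show ?thesis using upper_triangularD[OF upper, of l i] P less.prems by simp
        next
          case False
          then have "n - l < n - i" "l < n" "j < l" using l less.prems by auto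
          then show ?thesis using less.hyps[of l] by simp
        qed
      qed
    qed (use less.prems in auto)
    finally show ?case using diag[of i] less.prems by simp
  qed
qed


section \<open>Nonzero superdiagonal and similarity to the nilpotent Jordan block\<close>

lemma pow_mat_Suc_left:
  fixes A :: "'a::semiring_1 mat"
  assumes A: "A \<in> carrier_mat n n"
  shows "A ^\<^sub>m Suc k = A * A ^\<^sub>m k"
proof (induction k)
  case 0
  then show ?case using A by simp
next
  case (Suc k)
  have "A ^\<^sub>m Suc (Suc k) = A * A ^\<^sub>m k * A" using Suc by simp
  also have "\<dots> = A * (A ^\<^sub>m k * A)" using A by (intro assoc_mult_mat[of _ n n _ n _ n]) auto
  finally show ?case by simp
qed

lemma obtain_inverse_matrix:
  fixes P :: "'a::field mat"
  assumes P: "P \<in> carrier_mat n n" and "det P \<noteq> 0"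
  obtains Q where "Q \<in> carrier_mat n n" "P * Q = 1\<^sub>m n" "Q * P = 1\<^sub>m n"
  using det_non_zero_imp_unit[OF assms, unfolded Units_def, of "()"]
  by (auto simp: ring_mat_def)

lemma ex_similar_jordan_block:
  fixes A :: "'a::field mat"
  assumes A: "A \<in> carrier_mat n n" and strict: "strictly_upper_triangular A"
    and superdiag: "\<forall>i. Suc i < n \<longrightarrow> A $$ (i, Suc i) \<noteq> 0"
  shows "\<exists>Q Qinv. upper_triangular Q \<and> similar_mat_wit A (jordan_block n 0) Q Qinv"
proof -
  \<comment> \<open>The columns of \<open>Q\<close> are the Jordan chain generated by the last unit vector.\<close>
  define Q where "Q = mat n n (\<lambda>(i, k). (A ^\<^sub>m (n - 1 - k)) $$ (i, n - 1))"
  have Q: "Q \<in> carrier_mat n n" by (simp add: Q_def)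
  have upper: "upper_triangular Q"
    by (rule upper_triangularI)
      (auto simp: Q_def intro!: strictly_upper_triangular_pow_eq_0[OF A strict])
  have "Q $$ (k, k) \<noteq> 0" if "k < n" for k
  proof -
    \<comment> \<open>The column index \<open>n - 1\<close> is rewritten as
      \<open>k + (n - 1 - k)\<close>, which makes this an extremal entry of the power: a product of
      superdiagonal entries of \<open>A\<close>.\<close>
    have "Q $$ (k, k) = (A ^\<^sub>m (n - 1 - k)) $$ (k, k + (n - 1 - k))"
      using that by (simp add: Q_def)
    also have "\<dots> = (\<Prod>m<n - 1 - k. A $$ (k + m, Suc (k + m)))"
      using that by (intro strictly_upper_triangular_pow_diagonal[OF A strict]) auto
    also have "\<dots> \<noteq> 0" using superdiag by auto
    finally show ?thesis .
  qed
  then have "det Q \<noteq> 0" using det_upper_triangular_neq_0_iff[OF Q upper] by blast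
  then obtain Qinv where Qinv: "Qinv \<in> carrier_mat n n" "Q * Qinv = 1\<^sub>m n" "Qinv * Q = 1\<^sub>m n"
    using obtain_inverse_matrix[OF Q] by blast
  \<comment> \<open>Multiplication by \<open>A\<close> raises the exponent by one. This turns column
    \<open>k\<close> of \<open>Q\<close> into column \<open>k - 1\<close> when \<open>k > 0\<close>,
    and into zero when \<open>k = 0\<close>, because the \<open>n\<close>-th power of
    \<open>A\<close> vanishes; right multiplication by the Jordan block has the same effect.\<close>
  have AQ: "A * Q = Q * jordan_block n 0"
  proof (rule eq_matI)
    fix i k assume "i < dim_row (Q * jordan_block n 0)" "k < dim_col (Q * jordan_block n 0)"
    then have ik: "i < n" "k < n" using Q by auto
    have "(A * Q) $$ (i, k) = (A * A ^\<^sub>m (n - 1 - k)) $$ (i, n - 1)"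
      using A Q ik by (simp add: index_mult_mat_sum[of _ n n _ n] del: index_mult_mat(1))
        (simp add: Q_def)
    also have "\<dots> = (A ^\<^sub>m (n - k)) $$ (i, n - 1)"
      using ik by (simp add: pow_mat_Suc_left[OF A, symmetric] Suc_diff_Suc del: pow_mat.simps)
    also have "\<dots> = (Q * jordan_block n 0) $$ (i, k)"
    proof (cases k)
      case 0
      then show ?thesis using Q ik
        by (simp add: index_mult_mat_sum[of _ n n _ n] strictly_upper_triangular_pow_eq_0[OF A strict]
            del: index_mult_mat(1))
    next
      case (Suc l)
      have "(Q * jordan_block n 0) $$ (i, k) = (\<Sum>l<n. Q $$ (i, l) * (if Suc l = k then 1 else 0))"
        using Q ik
          by (auto simp: index_mult_mat_sum[of _ n n _ n] simp del: index_mult_mat(1) intro!: sum.cong)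
      also have "\<dots> = Q $$ (i, l)"
        using ik by (simp add: Suc if_distrib[of "\<lambda>x. _ * x"] cong: if_cong)
      finally show ?thesis using ik Suc by (simp add: Q_def)
    qed
    finally show "(A * Q) $$ (i, k) = (Q * jordan_block n 0) $$ (i, k)" .
  qed (use A Q in auto)
  have "A = A * (Q * Qinv)" using A Qinv by simp
  also have "\<dots> = Q * jordan_block n 0 * Qinv"
    unfolding AQ[symmetric] using A Q Qinv by (simp add: assoc_mult_mat[of _ n n _ n _ n])
  finally have "similar_mat_wit A (jordan_block n 0) Q Qinv"
    using A Q Qinv by (intro similar_mat_witI) auto
  then show ?thesis using upper by blast
qed

text \<open>The entries at \<open>(i, Suc i)\<close> of \<open>A * Q = Q * jordan_block n 0\<close>
  give \<open>A $$ (i, Suc i) * Q $$ (Suc i, Suc i) = Q $$ (i, i)\<close>, and the diagonal of the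
  invertible triangular \<open>Q\<close> has no zeros.\<close>

lemma superdiagonal_neq_0_of_similar_jordan_block:
  fixes A :: "'a::field mat"
  assumes A: "A \<in> carrier_mat n n" and strict: "strictly_upper_triangular A"
    and upper: "upper_triangular Q" and wit: "similar_mat_wit A (jordan_block n 0) Q Qinv"
    and i: "Suc i < n"
  shows "A $$ (i, Suc i) \<noteq> 0"
proof -
  note W = similar_mat_witD2[OF A wit]
  have diag: "Q $$ (k, k) \<noteq> 0" if "k < n" for k
    using that det_mult_eq_1_neq_0(1)[OF W(6,7,1)] det_upper_triangular_neq_0_iff[OF W(6) upper] by blast
  have "A * Q = Q * jordan_block n 0 * Qinv * Q" using arg_cong[OF W(3), of "\<lambda>X. X * Q"] .
  also have "\<dots> = Q * jordan_block n 0 * (Qinv * Q)"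
    using W by (intro assoc_mult_mat[of _ n n _ n _ n]) auto
  also have "\<dots> = Q * jordan_block n 0" using W by simp
  finally have AQ: "A * Q = Q * jordan_block n 0" .
  have "A $$ (i, Suc i) * Q $$ (Suc i, Suc i) = (\<Sum>l\<in>{Suc i}. A $$ (i, l) * Q $$ (l, Suc i))"
    by simp
  also have "\<dots> = (\<Sum>l<n. A $$ (i, l) * Q $$ (l, Suc i))"
  proof (rule sum.mono_neutral_left)
    show "\<forall>l\<in>{..<n} - {Suc i}. A $$ (i, l) * Q $$ (l, Suc i) = 0"
    proof
      fix l assume l: "l \<in> {..<n} - {Suc i}"
      then consider "l \<le> i" | "Suc i < l" by fastforce
      then show "A $$ (i, l) * Q $$ (l, Suc i) = 0"
        by cases (use l i A W(6) in \<open>auto simp: strictly_upper_triangularD[OF strict] upper_triangularD[OF upper]\<close>)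
    qed
  qed (use i in auto)
  also have "\<dots> = (Q * jordan_block n 0) $$ (i, Suc i)"
    unfolding AQ[symmetric] using A W(6) i
      by (simp add: index_mult_mat_sum[of _ n n _ n] del: index_mult_mat(1))
  also have "\<dots> = (\<Sum>l<n. Q $$ (i, l) * (if Suc l = Suc i then 1 else 0))"
    using W(6) i
      by (auto simp: index_mult_mat_sum[of _ n n _ n] simp del: index_mult_mat(1) intro!: sum.cong)
  also have "\<dots> = Q $$ (i, i)"
    using i by (simp add: if_distrib[of "\<lambda>x. _ * x"] cong: if_cong)
  finally show ?thesis using diag[of i] i by auto
qed

section \<open>The eigenvalue zero and its geometric multiplicity\<close>

lemma char_matrix_0: "A \<in> carrier_mat n n \<Longrightarrow> char_matrix A 0 = A"
  by (auto simp: char_matrix_def)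

lemma eigenvalue_strictly_upper_triangular_iff:
  fixes A :: "'a::field mat"
  assumes A: "A \<in> carrier_mat n n" and strict: "strictly_upper_triangular A" and "n \<ge> 1"
  shows "eigenvalue A e \<longleftrightarrow> e = 0"
proof -
  have "upper_triangular (char_matrix A e)"
    using A by (auto simp: char_matrix_def upper_triangular_def strictly_upper_triangularD[OF strict])
  then have "det (char_matrix A e) \<noteq> 0 \<longleftrightarrow> (\<forall>i<n. char_matrix A e $$ (i, i) \<noteq> 0)"
    using A by (intro det_upper_triangular_neq_0_iff) auto
  also have "\<dots> \<longleftrightarrow> e \<noteq> 0"
    using A \<open>n \<ge> 1\<close>
      by (auto simp: char_matrix_def strictly_upper_triangularD[OF strict] Suc_le_eq)
  finally show ?thesis using eigenvalue_det[OF A] by blast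
qed

text \<open>The dimension of an eigenspace is the number of Jordan blocks for that eigenvalue, here
  one. The size \<open>n\<close> must be positive, as a Jordan normal form has no empty
  blocks.\<close>

lemma geometric_multiplicity_of_similar_jordan_block:
  assumes A: "A \<in> carrier_mat n n" and "n \<ge> 1"
    and wit: "similar_mat_wit A (jordan_block n 0) Q Qinv"
  shows "geometric_multiplicity A 0 = 1"
proof -
  have "jordan_matrix [(n, 0)] = (jordan_block n 0 :: real mat)"
    by (intro eq_matI) (auto simp: jordan_matrix_def)
  then have "jordan_nf A [(n, 0)]"
    using wit \<open>n \<ge> 1\<close> unfolding jordan_nf_def similar_mat_def by auto
  from dim_gen_eigenspace[OF this, of 0 1] show ?thesis
    using A \<open>n \<ge> 1\<close> by (simp add: dim_gen_eigenspace_def geometric_multiplicity_def)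
qed

lemma superdiagonal_neq_0_of_kernel_dim:
  fixes A :: "'a::field mat"
  assumes A: "A \<in> carrier_mat n n" and strict: "strictly_upper_triangular A"
    and dim: "kernel_dim A = 1" and i: "Suc i < n"
  shows "A $$ (i, Suc i) \<noteq> 0"
proof
  assume zero: "A $$ (i, Suc i) = 0"
  obtain m where m: "n = Suc m" using i by (cases n) auto
  \<comment> \<open>\<open>S\<close> is \<open>A\<close> without its first column and last row, both of which vanish; a kernel vector of
    \<open>S\<close> yields a kernel vector of \<open>A\<close> independent of the first unit vector.\<close>
  define S where "S = mat m m (\<lambda>(i, j). A $$ (i, Suc j))"
  have S: "S \<in> carrier_mat m m" by (simp add: S_def)
  have "upper_triangular S"
    by (rule upper_triangularI) (use A m in \<open>auto simp: S_def strictly_upper_triangularD[OF strict]\<close>)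
  then have "det S = 0"
    using det_upper_triangular_neq_0_iff[OF S] zero i m by (auto simp: S_def)
  then obtain w where w: "w \<in> carrier_vec m" "w \<noteq> 0\<^sub>v m" "S *\<^sub>v w = 0\<^sub>v m"
    using det_0_iff_vec_prod_zero[OF S] by blast
  then obtain k where k: "k < m" "w $ k \<noteq> 0" by (metis carrier_vecD eq_vecI index_zero_vec)
  define v where "v = vec n (\<lambda>j. if j = 0 then 0 else w $ (j - 1))"
  have v: "v \<in> carrier_vec n" by (simp add: v_def)
  have "A *\<^sub>v v = 0\<^sub>v n"
  proof (rule eq_vecI)
    fix r assume "r < dim_vec (0\<^sub>v n :: 'a Matrix.vec)"
    then have r: "r < n" by simp
    have "(A *\<^sub>v v) $ r = (\<Sum>j<m. A $$ (r, Suc j) * w $ j)"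
      using A v r by (simp add: index_mult_mat_vec_sum[of _ n n] del: index_mult_mat_vec)
        (simp add: m sum.lessThan_Suc_shift v_def del: sum.lessThan_Suc)
    also have "\<dots> = 0"
    proof (cases "r < m")
      case True
      then have "(\<Sum>j<m. A $$ (r, Suc j) * w $ j) = (S *\<^sub>v w) $ r"
        using S w(1)
          by (simp add: index_mult_mat_vec_sum[of _ m m] del: index_mult_mat_vec) (simp add: S_def)
      then show ?thesis using w True by simp
    next
      \<comment> \<open>Here \<open>r = m\<close> is the last row of \<open>A\<close>, which
        vanishes.\<close>
      case False
      then show ?thesis
        using A r m by (intro sum.neutral) (auto simp: strictly_upper_triangularD[OF strict])
    qed
    finally show "(A *\<^sub>v v) $ r = 0\<^sub>v n $ r" using r by simp
  qed (use A in auto)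
  then have vK: "v \<in> mat_kernel A" by (rule mat_kernelI[OF A v])
  have uK: "unit_vec n 0 \<in> mat_kernel A"
  proof (rule mat_kernelI[OF A])
    show "A *\<^sub>v unit_vec n 0 = 0\<^sub>v n"
      using A m by (intro eq_vecI) (auto simp: strictly_upper_triangularD[OF strict])
  qed simp
  interpret kernel n n A by unfold_locales (rule A)
  obtain X where X: "finite X" "basis X" using kernel_basis_exists[OF A] by blast
  then have "card X = 1" using Ker.dim_basis dim by simp
  then obtain b where b: "X = {b}" by (auto simp: card_1_singleton_iff)
  have bK: "{b} \<subseteq> mat_kernel A" using X b unfolding Ker.basis_def by auto
  \<comment> \<open>The kernel is spanned by the single vector \<open>b\<close>, so
    \<open>unit_vec n 0\<close> and \<open>v\<close> are both multiples of it.\<close>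
  have multiple: "\<exists>c. \<forall>i<n. u $ i = c * b $ i" if "u \<in> mat_kernel A" for u
  proof -
    have "u \<in> span {b}" using X b that unfolding Ker.basis_def by auto
    then obtain a where "u = lincomb a {b}"
      using Ker.finite_span[of "{b}"] bK by auto
    then show ?thesis using lincomb_index[OF _ bK] by auto
  qed
  obtain c d where c: "\<forall>i<n. unit_vec n 0 $ i = c * b $ i" and d: "\<forall>i<n. v $ i = d * b $ i"
    using multiple[OF uK] multiple[OF vK] by blast
  \<comment> \<open>The unit vector forces \<open>b $ 0 \<noteq> 0\<close>, while
    \<open>v $ 0 = 0\<close>; hence \<open>d = 0\<close>, and \<open>v\<close> would vanish although
    it contains the nonzero entry \<open>w $ k\<close>.\<close>
  have "c * b $ 0 = 1" "d * b $ 0 = 0" using c d m by (auto simp: v_def)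
  then have "d = 0" by auto
  moreover have "v $ Suc k = w $ k" using k m by (simp add: v_def)
  ultimately show False using d k m by auto
qed

section \<open>Linear independence of the first row of \<open>mat_powr\<close>\<close>

lemma lin_indep_family_on_finite:
  assumes "finite I"
  shows "lin_indep_family_on S I f \<longleftrightarrow>
    (\<forall>c. (\<forall>x\<in>S. (\<Sum>j\<in>I. c j * f j x) = 0) \<longrightarrow> (\<forall>j\<in>I. c j = 0))" (is "_ \<longleftrightarrow> ?R")
proof
  assume "lin_indep_family_on S I f"
  then show ?R using assms unfolding lin_indep_family_on_def by blast
next
  assume R: ?R
  show "lin_indep_family_on S I f"
    unfolding lin_indep_family_on_def
  proof (intro allI impI)
    fix J c assume J: "finite J \<and> J \<subseteq> I \<and> (\<forall>x\<in>S. (\<Sum>j\<in>J. c j * f j x) = 0)"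
    \<comment> \<open>A relation on a subfamily is extended to all of \<open>I\<close> by zero
      coefficients.\<close>
    let ?c = "\<lambda>j. if j \<in> J then c j else 0"
    have "(\<Sum>j\<in>I. ?c j * f j x) = (\<Sum>j\<in>J. c j * f j x)" for x
      using J assms by (intro sum.mono_neutral_cong_right) auto
    then have "\<forall>j\<in>I. ?c j = 0" using spec[OF R, of ?c] J by simp
    then show "\<forall>j\<in>J. c j = 0" using J by (auto split: if_splits)
  qed
qed

text \<open>A linear relation between the functions is a polynomial identity in \<open>ln x\<close>.
  Comparing coefficients turns it into a homogeneous linear system with a triangular matrix, so
  independence means that its determinant is nonzero.\<close>

lemma lin_indep_mat_powr_first_row_iff:
  assumes A: "A \<in> carrier_mat n n" and strict: "strictly_upper_triangular A" and n: "n \<ge> 1"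
  shows "lin_indep_family_on {0<..} {1..<n} (\<lambda>j x. mat_powr x A $$ (0, j)) \<longleftrightarrow>
    (\<forall>i. Suc i < n \<longrightarrow> A $$ (i, Suc i) \<noteq> 0)"
proof -
  obtain m where m: "n = Suc m" using n by (cases n) auto
  \<comment> \<open>The functions are polynomials in \<open>ln x\<close>; row \<open>k\<close> of \<open>M\<close> holds their coefficients of degree
    \<open>k + 1\<close>, up to the factor \<open>(k + 1)!\<close>.\<close>
  define M where "M = mat m m (\<lambda>(k, j). (A ^\<^sub>m Suc k) $$ (0, Suc j))"
  have M: "M \<in> carrier_mat m m" by (simp add: M_def)
  have upper: "upper_triangular M"
    by (rule upper_triangularI)
      (use m in \<open>auto simp: M_def strictly_upper_triangular_pow_eq_0[OF A strict]
          simp del: pow_mat.simps\<close>)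
  have diag: "M $$ (i, i) = (\<Prod>l\<le>i. A $$ (l, Suc l))" if "i < m" for i
    using that m strictly_upper_triangular_pow_diagonal[OF A strict, of 0 "Suc i"]
    by (simp add: M_def lessThan_Suc_atMost del: pow_mat.simps)
  \<comment> \<open>The diagonal of \<open>M\<close> consists of the products over the initial
    segments of the superdiagonal of \<open>A\<close>; they are all nonzero exactly if every single
    factor is.\<close>
  have superdiag: "det M \<noteq> 0 \<longleftrightarrow> (\<forall>i. Suc i < n \<longrightarrow> A $$ (i, Suc i) \<noteq> 0)"
    unfolding det_upper_triangular_neq_0_iff[OF M upper] using m by (auto simp: diag)
  have vanish: "(\<forall>x\<in>{0<..}. (\<Sum>j\<in>{1..<n}. c j * mat_powr x A $$ (0, j)) = 0) \<longleftrightarrow>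
      M *\<^sub>v vec m (\<lambda>j. c (Suc j)) = 0\<^sub>v m" (is "?L \<longleftrightarrow> ?R") for c
  proof -
    define a where "a k = (\<Sum>j\<in>{1..<n}. c j * (A ^\<^sub>m k) $$ (0, j)) / fact k" for k
    have expand: "(\<Sum>j\<in>{1..<n}. c j * mat_powr x A $$ (0, j)) = (\<Sum>k\<le>m. a k * ln x ^ k)" for x
    proof -
      have "(\<Sum>j\<in>{1..<n}. c j * mat_powr x A $$ (0, j))
          = (\<Sum>j\<in>{1..<n}. \<Sum>k\<le>m. c j * (ln x ^ k / fact k * (A ^\<^sub>m k) $$ (0, j)))"
        using m by (intro sum.cong)
          (auto simp: mat_powr_index_strictly_upper_triangular[OF A strict] sum_distrib_left
            lessThan_Suc_atMost simp del: sum.lessThan_Suc)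
      also have "\<dots> = (\<Sum>k\<le>m. \<Sum>j\<in>{1..<n}. c j * (ln x ^ k / fact k * (A ^\<^sub>m k) $$ (0, j)))"
        by (rule sum.swap)
      also have "\<dots> = (\<Sum>k\<le>m. a k * ln x ^ k)"
        by (simp add: a_def sum_distrib_left sum_distrib_right sum_divide_distrib mult_ac)
      finally show ?thesis .
    qed
    have "?L \<longleftrightarrow> (\<forall>x\<in>{0<..}. (\<Sum>k\<le>m. a k * ln x ^ k) = 0)"
      by (simp only: expand)
    \<comment> \<open>The logarithm maps the positive reals onto all reals.\<close>
    also have "\<dots> \<longleftrightarrow> (\<forall>y. (\<Sum>k\<le>m. a k * y ^ k) = 0)"
      
    proof (intro iffI allI ballI)
      fix y assume "\<forall>x\<in>{0<..}. (\<Sum>k\<le>m. a k * ln x ^ k) = 0"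
      from bspec[OF this, of "exp y"] show "(\<Sum>k\<le>m. a k * y ^ k) = 0" by simp
    qed simp
    also have "\<dots> \<longleftrightarrow> (\<forall>k\<le>m. a k = 0)" by (rule polyfun_eq_0)
    \<comment> \<open>The constant term is zero, since the identity matrix has no nonzero entry
      \<open>(0, j)\<close> with \<open>j \<ge> 1\<close>; so the rows of \<open>M\<close> may start
      at degree one.\<close>
    also have "\<dots> \<longleftrightarrow> (\<forall>k<m. a (Suc k) = 0)"
    proof -
      have "a 0 = 0" using A by (simp add: a_def)
      then have "a k = 0" if "\<forall>k<m. a (Suc k) = 0" "k \<le> m" for k using that by (cases k) auto
      then show ?thesis by auto
    qed
    also have "\<dots> \<longleftrightarrow> (\<forall>k<m. (M *\<^sub>v vec m (\<lambda>j. c (Suc j))) $ k = 0)"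
    proof -
      have "a (Suc k) = (M *\<^sub>v vec m (\<lambda>j. c (Suc j))) $ k / fact (Suc k)" if "k < m" for k
      proof -
        have "(M *\<^sub>v vec m (\<lambda>j. c (Suc j))) $ k = (\<Sum>j<m. c (Suc j) * (A ^\<^sub>m Suc k) $$ (0, Suc j))"
          using that M
            by (simp add: index_mult_mat_vec_sum[of _ m m] mult.commute
                del: index_mult_mat_vec pow_mat.simps)
            (simp add: M_def mult.commute del: pow_mat.simps)
        also have "\<dots> = (\<Sum>j\<in>{1..<n}. c j * (A ^\<^sub>m Suc k) $$ (0, j))"
          unfolding m One_nat_def by (simp only: sum.shift_bounds_Suc_ivl lessThan_atLeast0)
        finally show ?thesis by (simp add: a_def)
      qed
      then show ?thesis by simp
    qed
    also have "\<dots> \<longleftrightarrow> ?R" using M by (auto simp: vec_eq_iff)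
    finally show ?thesis .
  qed
  have "lin_indep_family_on {0<..} {1..<n} (\<lambda>j x. mat_powr x A $$ (0, j)) \<longleftrightarrow>
      (\<forall>c. M *\<^sub>v vec m (\<lambda>j. c (Suc j)) = 0\<^sub>v m \<longrightarrow> (\<forall>j\<in>{1..<n}. c j = 0))"
    by (simp only: lin_indep_family_on_finite finite_atLeastLessThan vanish)
  also have "\<dots> \<longleftrightarrow> (\<forall>v. v \<in> carrier_vec m \<and> M *\<^sub>v v = 0\<^sub>v m \<longrightarrow> v = 0\<^sub>v m)"
  proof (intro iffI allI impI)
    fix v assume L: "\<forall>c. M *\<^sub>v vec m (\<lambda>j. c (Suc j)) = 0\<^sub>v m \<longrightarrow> (\<forall>j\<in>{1..<n}. c j = (0::real))"
      and v: "v \<in> carrier_vec m \<and> M *\<^sub>v v = 0\<^sub>v m"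
    \<comment> \<open>The coefficients chosen for \<open>v\<close> are \<open>v $ (j - 1)\<close>,
      undoing the shift between the index set \<open>{1..<n}\<close> and vectors of length
      \<open>m\<close>.\<close>
    have "vec m (\<lambda>j. v $ (Suc j - 1)) = v" using v by auto
    with spec[OF L, of "\<lambda>j. v $ (j - 1)"] v have *: "\<forall>j\<in>{1..<n}. v $ (j - 1) = 0" by simp
    have "v $ j = 0" if "j < m" for j
      using bspec[OF *, of "Suc j"] that m by simp
    then show "v = 0\<^sub>v m" using v by auto
  next
    fix c :: "nat \<Rightarrow> real"
    assume R: "\<forall>v. v \<in> carrier_vec m \<and> M *\<^sub>v v = 0\<^sub>v m \<longrightarrow> v = 0\<^sub>v m"
      and c: "M *\<^sub>v vec m (\<lambda>j. c (Suc j)) = 0\<^sub>v m"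
    then have 0: "vec m (\<lambda>j. c (Suc j)) = 0\<^sub>v m" by simp
    have "c (Suc j) = 0" if "j < m" for j
      using arg_cong[OF 0, of "\<lambda>v. v $ j"] that by simp
    then show "\<forall>j\<in>{1..<n}. c j = 0" using m by (auto simp: Suc_le_eq gr0_conv_Suc)
  qed
  also have "\<dots> \<longleftrightarrow> det M \<noteq> 0" using det_0_iff_vec_prod_zero[OF M] by blast
  finally show ?thesis using superdiag by simp
qed

section \<open>Rate vectors and regular variation under triangular transformations\<close>

lemma index_matrix_strictly_upper_triangular:
  assumes A: "A \<in> carrier_mat n n" and strict: "strictly_upper_triangular A" and "n \<ge> 1"
  shows "index_matrix n A"
  \<comment> \<open>Zero is the only eigenvalue, so no eigenvalue exceeds another and the
    multiplicity condition is vacuous.\<close>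
  using A strict unfolding index_matrix_def
  by (auto simp: eigenvalue_strictly_upper_triangular_iff[OF assms]
      strictly_upper_triangularD[OF strict] strictly_upper_triangular_iff)

lemma rate_vector_smallo:
  assumes g: "rate_vector n D g" and "i < j" "j < n"
  shows "(\<lambda>t. g t $ j) \<in> o(\<lambda>t. g t $ i)"
  using assms(2,3)
proof (induction j)
  case (Suc j)
  have step: "(\<lambda>t. g t $ Suc j) \<in> o(\<lambda>t. g t $ j)"
    using g Suc.prems by (auto simp: rate_vector_def)
  show ?case
  proof (cases "i = j")
    case False
    then show ?thesis using Suc by (intro landau_o.small_trans[OF step]) auto
  qed (use step in simp)
qed simp

lemma rate_vector_eventually_mem:
  "rate_vector n D g \<Longrightarrow> \<forall>\<^sub>F t in at_top. t \<in> D"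
  unfolding rate_vector_def eventually_at_top_linorder by (auto simp: subset_iff)

text \<open>Component \<open>i\<close> of \<open>P *\<^sub>v g t\<close> involves only the
  components of \<open>g\<close> from \<open>i\<close> onwards, and those after \<open>i\<close> are
  of smaller order than the \<open>i\<close>-th.\<close>

lemma upper_triangular_mult_asymp_equiv:
  assumes g: "rate_vector n D g" and P: "P \<in> carrier_mat n n" and upper: "upper_triangular P"
    and h: "\<forall>t\<in>D. h t = P *\<^sub>v g t" and i: "i < n" "P $$ (i, i) \<noteq> 0"
  shows "(\<lambda>t. h t $ i) \<sim>[at_top] (\<lambda>t. P $$ (i, i) * g t $ i)"
proof (rule smallo_imp_asymp_equiv)
  have "h t $ i - P $$ (i, i) * g t $ i = (\<Sum>l\<in>{i<..<n}. P $$ (i, l) * g t $ l)" if "t \<in> D" for t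
  proof -
    have "g t \<in> carrier_vec n" using g that by (auto simp: rate_vector_def)
    then have "h t $ i = (\<Sum>l<n. P $$ (i, l) * g t $ l)"
      using h that P i by (simp add: index_mult_mat_vec_sum[of _ n n] del: index_mult_mat_vec)
    also have "\<dots> = (\<Sum>l\<in>{i..<n}. P $$ (i, l) * g t $ l)"
      using P i by (intro sum.mono_neutral_right) (auto simp: upper_triangularD[OF upper])
    also have "{i..<n} = insert i {i<..<n}" using i by auto
    finally show ?thesis by simp
  qed
  then have "\<forall>\<^sub>F t in at_top. h t $ i - P $$ (i, i) * g t $ i = (\<Sum>l\<in>{i<..<n}. P $$ (i, l) * g t $ l)"
    using rate_vector_eventually_mem[OF g] by (auto elim: eventually_mono)
  moreover have "(\<lambda>t. \<Sum>l\<in>{i<..<n}. P $$ (i, l) * g t $ l) \<in> o(\<lambda>t. P $$ (i, i) * g t $ i)"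
    using i rate_vector_smallo[OF g]
      by (intro big_sum_in_smallo) (auto simp: landau_o.small.cmult_in_iff)
  ultimately show "(\<lambda>t. h t $ i - P $$ (i, i) * g t $ i) \<in> o(\<lambda>t. P $$ (i, i) * g t $ i)"
    by (simp cong: landau_o.small.in_cong)
qed

text \<open>Each component inherits its eventual sign and its order of magnitude from its leading
  term, a nonzero multiple of the corresponding component of \<open>g\<close>.\<close>

lemma rate_vector_upper_triangular_mult:
  assumes g: "rate_vector n D g" and P: "P \<in> carrier_mat n n" and upper: "upper_triangular P"
    and det: "det P \<noteq> 0" and h: "\<forall>t\<in>D. h t = P *\<^sub>v g t"
  shows "rate_vector n D h"
proof -
  have diag: "P $$ (i, i) \<noteq> 0" if "i < n" for i
    using that det det_upper_triangular_neq_0_iff[OF P upper] by blast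
  note equiv = upper_triangular_mult_asymp_equiv[OF g P upper h _ diag]
  have "eventually_constant_sign (\<lambda>t. h t $ i)" if i: "i < n" for i
  proof -
    have same: "\<forall>\<^sub>F t in at_top. sgn (h t $ i) = sgn (P $$ (i, i) * g t $ i)"
      using asymp_equiv_imp_eventually_same_sign[OF equiv[OF i i]] .
    have "eventually_constant_sign (\<lambda>t. g t $ i)" using g i by (simp add: rate_vector_def)
    then have "eventually_constant_sign (\<lambda>t. P $$ (i, i) * g t $ i)"
      using diag[OF i] unfolding eventually_constant_sign_def
      by (cases "P $$ (i, i) > 0") (auto simp: zero_less_mult_iff mult_less_0_iff)
    then show ?thesis
      unfolding eventually_constant_sign_def
    proof (elim disjE)
      assume "\<forall>\<^sub>F t in at_top. 0 < P $$ (i, i) * g t $ i"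
      with same have "\<forall>\<^sub>F t in at_top. 0 < h t $ i"
        by eventually_elim (metis sgn_greater)
      then show "(\<forall>\<^sub>F t in at_top. 0 < h t $ i) \<or> (\<forall>\<^sub>F t in at_top. h t $ i < 0)" ..
    next
      assume "\<forall>\<^sub>F t in at_top. P $$ (i, i) * g t $ i < 0"
      with same have "\<forall>\<^sub>F t in at_top. h t $ i < 0"
        by eventually_elim (metis sgn_less)
      then show "(\<forall>\<^sub>F t in at_top. 0 < h t $ i) \<or> (\<forall>\<^sub>F t in at_top. h t $ i < 0)" ..
    qed
  qed
  moreover have "(\<lambda>t. h t $ Suc i) \<in> o(\<lambda>t. h t $ i)" if i: "Suc i < n" for i
  proof -
    have "i < n" using i by simp
    have "(\<lambda>t. P $$ (Suc i, Suc i) * g t $ Suc i) \<in> o(\<lambda>t. P $$ (i, i) * g t $ i)"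
      using g i diag[OF i] diag[OF \<open>i < n\<close>] by (simp add: rate_vector_def)
    with asymp_equiv_imp_bigo[OF equiv[OF i i]]
    have "(\<lambda>t. h t $ Suc i) \<in> o(\<lambda>t. P $$ (i, i) * g t $ i)"
      by (rule landau_o.big_small_trans)
    \<comment> \<open>The asymptotic equivalence now serves as a lower bound for
      \<open>h t $ i\<close>.\<close>
    also have "(\<lambda>t. P $$ (i, i) * g t $ i) \<in> O(\<lambda>t. h t $ i)"
      using asymp_equiv_imp_bigomega[OF equiv[OF \<open>i < n\<close> \<open>i < n\<close>]]
        by (simp add: bigomega_iff_bigo)
    finally show ?thesis .
  qed
  ultimately show ?thesis
    using g P h unfolding rate_vector_def by auto
qed

lemma measurable_vector_mult:
  assumes meas: "measurable_vector n D g" and carrier: "\<forall>t\<in>D. g t \<in> carrier_vec n"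
    and P: "P \<in> carrier_mat n n" and h: "\<forall>t\<in>D. h t = P *\<^sub>v g t"
  shows "measurable_vector n D h"
proof -
  have D: "D \<in> sets lebesgue" using meas by (simp add: measurable_vector_def)
  have "(\<lambda>t. h t $ i) \<in> borel_measurable (lebesgue_on D)" if i: "i < n" for i
  proof -
    have sum: "(\<lambda>t. \<Sum>l<n. P $$ (i, l) * g t $ l) \<in> borel_measurable (lebesgue_on D)"
      using meas
        by (intro borel_measurable_sum borel_measurable_times) (auto simp: measurable_vector_def)
    have "h t $ i = (\<Sum>l<n. P $$ (i, l) * g t $ l)" if "t \<in> space (lebesgue_on D)" for t
      using that carrier h P i
      by (simp add: index_mult_mat_vec_sum[of _ n n] del: index_mult_mat_vec)
    from measurable_cong[of "lebesgue_on D", OF this] show ?thesis using sum by (rule iffD2)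
  qed
  then show ?thesis using D by (simp add: measurable_vector_def)
qed

text \<open>From \<open>mat_powr x B * Q = Q * mat_powr x A\<close> it follows that the error term
  of \<open>h\<close> is \<open>Q\<close> applied to the error term of \<open>g\<close>. The
  statement is symmetric enough to yield both directions of the final equivalence, by exchanging the
  two matrices and the two transformations.\<close>

lemma regularly_varying_similar:
  assumes n: "n \<ge> 1" and A: "A \<in> carrier_mat n n" and wit: "similar_mat_wit A B P Q"
    and strict: "strictly_upper_triangular A" "strictly_upper_triangular B"
    and upper: "upper_triangular Q"
    and rv: "regularly_varying n A D g" and h: "\<forall>t\<in>D. h t = Q *\<^sub>v g t"
  shows "regularly_varying n B D h"
proof -
  note W = similar_mat_witD2[OF A wit]
  have g: "rate_vector n D g" and meas: "measurable_vector n D g"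
    using rv by (auto simp: regularly_varying_def)
  have gC: "g t \<in> carrier_vec n" if "t \<in> D" for t using g that by (auto simp: rate_vector_def)
  have det: "det Q \<noteq> 0" using det_mult_eq_1_neq_0(2)[OF W(6,7,1)] .
  have "n - 1 < n" using n by simp
  then have "Q $$ (n - 1, n - 1) \<noteq> 0"
    using det det_upper_triangular_neq_0_iff[OF W(7) upper] by blast
  \<comment> \<open>The last components of \<open>g\<close> and \<open>h\<close> have the same
    order, so error bounds relative to either are interchangeable.\<close>
  from asymp_equiv_imp_bigtheta[OF upper_triangular_mult_asymp_equiv[OF g W(7) upper h \<open>n - 1 < n\<close> this]] this
  have last: "(\<lambda>t. h t $ (n - 1)) \<in> \<Theta>(\<lambda>t. g t $ (n - 1))" by simp
  have "\<forall>x>0. \<forall>i<n. (\<lambda>t. (h (x * t) - mat_powr x B *\<^sub>v h t) $ i) \<in> o(\<lambda>t. h t $ (n - 1))"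
  proof (intro allI impI)
    fix x :: real and i assume x: "x > 0" and i: "i < n"
    note C = mat_powr_carrier[OF A, of x] mat_powr_carrier[OF W(5), of x]
    define e where "e t = g (x * t) - mat_powr x A *\<^sub>v g t" for t
    have "similar_mat_wit (mat_powr x A) (mat_powr x B) P Q"
      using W C mat_powr_similar[OF A wit strict] by (intro similar_mat_witI[of _ _ n]) auto
    from similar_mat_witD2(3)[OF C(2) similar_mat_wit_sym[OF this]]
    have "mat_powr x B * Q = Q * mat_powr x A * P * Q" by simp
    also have "\<dots> = Q * mat_powr x A * (P * Q)"
      using W C by (intro assoc_mult_mat[of _ n n _ n _ n]) auto
    also have "\<dots> = Q * mat_powr x A" using W C by simp
    finally have comm: "mat_powr x B * Q = Q * mat_powr x A" .
    have eq: "(h (x * t) - mat_powr x B *\<^sub>v h t) $ i = (\<Sum>l<n. Q $$ (i, l) * e t $ l)"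
      if t: "t \<in> D" "x * t \<in> D" for t
    proof -
      have "mat_powr x B *\<^sub>v h t = (mat_powr x B * Q) *\<^sub>v g t"
        using h t gC[OF t(1)] W C by simp
      also have "\<dots> = Q *\<^sub>v (mat_powr x A *\<^sub>v g t)"
        unfolding comm using gC[OF t(1)] W C by simp
      finally have "h (x * t) - mat_powr x B *\<^sub>v h t = Q *\<^sub>v e t"
        using h t gC[OF t(1)] gC[OF t(2)] W C by (simp add: e_def mult_minus_distrib_mat_vec[of _ n n])
      moreover have "e t \<in> carrier_vec n" using gC[OF t(1)] gC[OF t(2)] C by (simp add: e_def)
      ultimately show ?thesis
        using i W by (simp add: index_mult_mat_vec_sum[of _ n n] del: index_mult_mat_vec)
    qed
    \<comment> \<open>As \<open>x > 0\<close>, \<open>x * t\<close> tends to infinity with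
      \<open>t\<close>, so both arguments eventually lie in the domain, where \<open>h\<close> is
      given by \<open>Q\<close>.\<close>
    have "\<forall>\<^sub>F t in at_top. x * t \<in> D"
      using rate_vector_eventually_mem[OF g] filterlim_tendsto_pos_mult_at_top[OF tendsto_const x filterlim_ident]
      by (rule eventually_compose_filterlim)
    with rate_vector_eventually_mem[OF g]
    have "\<forall>\<^sub>F t in at_top. (h (x * t) - mat_powr x B *\<^sub>v h t) $ i = (\<Sum>l<n. Q $$ (i, l) * e t $ l)"
      by eventually_elim (rule eq)
    moreover have "(\<lambda>t. \<Sum>l<n. Q $$ (i, l) * e t $ l) \<in> o(\<lambda>t. g t $ (n - 1))"
      using rv x unfolding e_def
      by (intro big_sum_in_smallo) (auto simp: landau_o.small.cmult_in_iff regularly_varying_def)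
    ultimately have "(\<lambda>t. (h (x * t) - mat_powr x B *\<^sub>v h t) $ i) \<in> o(\<lambda>t. g t $ (n - 1))"
      by (simp cong: landau_o.small.in_cong)
    then show "(\<lambda>t. (h (x * t) - mat_powr x B *\<^sub>v h t) $ i) \<in> o(\<lambda>t. h t $ (n - 1))"
      by (simp only: landau_o.small.cong_bigtheta[OF last])
  qed
  moreover have "measurable_vector n D h" using measurable_vector_mult[OF meas _ W(7) h] gC by blast
  ultimately show ?thesis
    using index_matrix_strictly_upper_triangular[OF W(5) strict(2) n]
      rate_vector_upper_triangular_mult[OF g W(7) upper det h]
    by (simp only: regularly_varying_def simp_thms)
qed

theorem proposition5p1:
  fixes n :: nat and B :: "real mat"
  assumes "n \<ge> 1"
    and "B \<in> carrier_mat n n"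
    and "upper_triangular B"
    and "\<forall>i<n. B $$ (i, i) = 0"
  shows
    "((\<forall>i. Suc i < n \<longrightarrow> B $$ (i, Suc i) \<noteq> 0) \<longleftrightarrow>
      (\<exists>Q Qinv. upper_triangular Q \<and> similar_mat_wit B (jordan_block n 0) Q Qinv)) \<and>
     ((\<exists>Q Qinv. upper_triangular Q \<and> similar_mat_wit B (jordan_block n 0) Q Qinv) \<longleftrightarrow>
      (eigenvalue B 0 \<and> geometric_multiplicity B 0 = 1)) \<and>
     ((eigenvalue B 0 \<and> geometric_multiplicity B 0 = 1) \<longleftrightarrow>
      lin_indep_family_on {0<..} {1..<n} (\<lambda>j x. mat_powr x B $$ (0, j))) \<and>
     (\<forall>Q Qinv D g.
        upper_triangular Q \<and> similar_mat_wit B (jordan_block n 0) Q Qinv \<and> rate_vector n D g \<longrightarrow>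
        (regularly_varying n B D g \<longleftrightarrow>
         regularly_varying n (jordan_block n 0) D (\<lambda>t. Qinv *\<^sub>v g t)))"
proof -
  note n = assms(1) and B = assms(2)
  have strict: "strictly_upper_triangular B"
    using assms by (auto simp: strictly_upper_triangular_iff)
  have J: "jordan_block n 0 \<in> carrier_mat n n" by simp
  let ?i = "\<forall>i. Suc i < n \<longrightarrow> B $$ (i, Suc i) \<noteq> 0"
  let ?ii = "\<exists>Q Qinv. upper_triangular Q \<and> similar_mat_wit B (jordan_block n 0) Q Qinv"
  let ?iii = "eigenvalue B 0 \<and> geometric_multiplicity B 0 = 1"
  \<comment> \<open>The first three conditions are linked by (i) iff (ii), (ii) to (iii) and (iii)
    to (i); condition (iv) is compared with (i) at the end.\<close>
  have "?i \<longleftrightarrow> ?ii"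
    using ex_similar_jordan_block[OF B strict]
      superdiagonal_neq_0_of_similar_jordan_block[OF B strict] by blast
  moreover have "?ii \<Longrightarrow> ?iii"
    using geometric_multiplicity_of_similar_jordan_block[OF B n]
      eigenvalue_strictly_upper_triangular_iff[OF B strict n] by blast
  moreover have "?iii \<Longrightarrow> ?i"
    using superdiagonal_neq_0_of_kernel_dim[OF B strict]
    by (auto simp: geometric_multiplicity_def char_matrix_0[OF B])
  moreover have "regularly_varying n B D g \<longleftrightarrow>
      regularly_varying n (jordan_block n 0) D (\<lambda>t. Qinv *\<^sub>v g t)"
    if Q: "upper_triangular Q" "similar_mat_wit B (jordan_block n 0) Q Qinv" and g: "rate_vector n D g"
    for Q Qinv D g
  proof
    note W = similar_mat_witD2[OF B Q(2)]
    have upper: "upper_triangular Qinv" by (rule upper_triangular_inverse[OF W(6,7,1) Q(1)])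
    show "regularly_varying n (jordan_block n 0) D (\<lambda>t. Qinv *\<^sub>v g t)"
      if "regularly_varying n B D g"
      by (rule regularly_varying_similar[OF n B Q(2) strict strictly_upper_triangular_jordan_block
            upper that]) simp
    \<comment> \<open>For the converse, \<open>g\<close> is recovered from
      \<open>Qinv *\<^sub>v g t\<close> by \<open>Q\<close>. This holds on \<open>D\<close>, where
      \<open>g\<close> takes values of length \<open>n\<close>.\<close>
    have "g t = Q *\<^sub>v (Qinv *\<^sub>v g t)" if "t \<in> D" for t
    proof -
      have "g t \<in> carrier_vec n" using g that by (auto simp: rate_vector_def)
      then show ?thesis using W by (simp flip: assoc_mult_mat_vec[of _ n n _ n])
    qed
    then show "regularly_varying n B D g"
      if "regularly_varying n (jordan_block n 0) D (\<lambda>t. Qinv *\<^sub>v g t)"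
      by (intro regularly_varying_similar[OF n J similar_mat_wit_sym[OF Q(2)]
            strictly_upper_triangular_jordan_block strict Q(1) that]) blast
  qed
  ultimately show ?thesis
    using lin_indep_mat_powr_first_row_iff[OF B strict n] by blast
qed

end
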